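(* Let $\widetilde u_{\mathrm{ms}}^\ell=\widetilde M_h^\ell(\widetilde u_H^\ell)$. Assume that there are $m_A,L_A>0$ with $$m_A\|v_h-w_h\|_V^2\le A(v_h;v_h-w_h)-A(w_h;v_h-w_h),\qquad \|A(v_h;\cdot)-A(w_h;\cdot)\|_{V_h'}\le L_A\|v_h-w_h\|_V\qquad\forall\,v_h,w_h\in\mathcal U_h,$$ and that $$\bigl\|\bigl(D\widetilde M_h^\ell(v_H)-D\widetilde M_h^\ell(w_H)\bigr)[\xi_H]\bigr\|_V\le L_{\widetilde M,1}^\ell\|v_H-w_H\|_V\|\xi_H\|_V\qquad\forall\,v_H,w_H\in\mathcal U_H,\ \forall\,\xi_H\in V_H .$$ Let $e_h=u_h-\widetilde u_{\mathrm{ms}}^\ell$, $\gamma_{\mathrm{ch}}^\ell=\tfrac12L_AL_{\widetilde M,1}^\ell C_\Pi^2$, $e_{\mathrm{loc}}^\ell=M_h(\Pi_Hu_h)-\widetilde M_h^\ell(\Pi_Hu_h)$, and let the reduced residual be $$\mathcal R_H^\ell(w_H)(\xi_H)=\operatorname{Res}\bigl(\widetilde M_h^\ell(w_H)\bigr)\bigl(D\widetilde M_h^\ell(w_H)[\xi_H]\bigr),\qquad \|\mathcal R_H^\ell(w_H)\|_{V_H'}=\sup_{\xi_H\in V_H\setminus\{0\}}\frac{|\mathcal R_H^\ell(w_H)(\xi_H)|}{\|\xi_H\|_V}.$$ If $\gamma_{\mathrm{ch}}^\ell\|e_h\|_V\le\tfrac12m_A$, then $$\|u_h-\widetilde u_{\mathrm{ms}}^\ell\|_V\le\frac{2}{m_A}\Bigl(L_A\|e_{\mathrm{loc}}^\ell\|_V+C_\Pi\|\mathcal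 R_H^\ell(\widetilde u_H^\ell)\|_{V_H'}\Bigr).$$
   Context: Basic setting. Let $\Omega$ be a bounded polygonal or polyhedral domain with nested, shape-regular, quasi-uniform triangulations $\mathcal T_H$ (coarse) and $\mathcal T_h$ (fine, a refinement of $\mathcal T_H$); $V_H\subset V_h$ are the corresponding (finite-dimensional) spaces of continuous piecewise linear finite element functions with homogeneous Dirichlet boundary conditions, and $\|\cdot\|_V$ is the energy norm on $V_h$. $A(\cdot;\cdot):V_h\times V_h\to\mathbb R$ is nonlinear in its first and linear in its second argument; $L:V_h\to\mathbb R$ is linear. $u_h\in V_h$ is the (unique) solution of $A(u_h;v_h)=L(v_h)$ for all $v_h\in V_h$. $\Pi_H:V_h\to V_H$ is a linear projection onto $V_H$ ($\Pi_Hv_H=v_H$ for $v_H\in V_H$) with $\|\Pi_Hv_h\|_V\le C_\Pi\|v_h\|_V$ for all $v_h\in V_h$; $V_f=\ker\Pi_H$. Dual norms are $\|F\|_{V_h'}=\sup_{0\ne v_h\in V_h}|F(v_h)|/\|v_h\|_V$. The residual is $\operatorname{Res}(z_h)(w_h)=L(w_h)-A(z_h;w_h)$ for $z_h,w_h\in V_h$. Ideal reconstruction. For $v_H\in V_H$, $v_f(v_H)\in V_f$ is the (assumed unique) solution of $A(v_H+v_f(v_H);w_f)=L(w_f)$ for all $w_f\in V_f$, and $M_h(v_H)=v_H+v_f(v_H)$; one has $u_h=M_h(\Pi_Hu_h)$. Computable reconstructions. $\{\varphi_{H,i}\}_{i\in\mathcal I}$ is a partition of unity subordinate to $\mathcal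 T_H$, each support being a union of coarse elements; $\omega_i^0=\operatorname{int}(\operatorname{supp}\varphi_{H,i})$, and $\omega_i^\ell$ is obtained from $\omega_i^0$ by adding $\ell\ge0$ times all coarse elements whose closure meets the closure of the current set. With a basis $\{\Phi_j\}$ of $V_H$, $P_iv_H\in\mathbb R^{n_{H,i}}$ is the vector of those coefficients of $v_H$ whose basis functions have support meeting $\omega_i^\ell$. $V_{f,i}^\ell=\{v_f\in V_f:\operatorname{supp}v_f\subset\overline{\omega_i^\ell},\ v_f=0\text{ on }\partial\omega_i^\ell\}$; $R_i$ is restriction to $\omega_i^0$, $E_{i,0}^{\mathrm{ext}}$ is extension by zero from $\omega_i^0$, and $I_h$ is a stable linear fine-grid interpolation or projection into $V_h$. The local correction $v_{f,i}^\ell(P_iv_H)\in V_{f,i}^\ell$ is the (assumed unique) solution of $A_{\omega_i^\ell}(v_H+v_{f,i}^\ell(P_iv_H);w)=L_{\omega_i^\ell}(w)$ for all $w\in V_{f,i}^\ell$, where $A_{\omega_i^\ell},L_{\omega_i^\ell}$ are the restrictions of $A,L$ to the patch. The map $\widetilde M_h^\ell:V_H\to V_h$ is $$\widetilde M_h^\ell(v_H)=v_H+(I-\Pi_H)I_h\Bigl(\sum_{i\in\mathcal I}\varphi_{H,i}E_{i,0}^{\mathrm{ext}}\,\widetilde g_i^\ell(P_iv_H)\Bigr),$$ where either $\widetilde g_i^\ell=R_iv_{f,i}^\ell$ for all $i$ (patch-solved reconstruction) or $\widetilde g_i^\ell=\mathcal N_{f,i}^{\ell,\theta_i}$ for all $i$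 (network-interpolated reconstruction), with $\mathcal N_{f,i}^{\ell,\theta_i}$ a given parametrized map from $\mathbb R^{n_{H,i}}$ to coefficient vectors identified with fine finite element functions on $\omega_i^0$. In particular $\Pi_H\widetilde M_h^\ell(v_H)=v_H$. Standing assumptions. $\mathcal U_h\subset V_h$ and $\mathcal U_H\subset V_H$ are admissible sets; $\widetilde M_h^\ell$ is differentiable on $\mathcal U_H$; $\widetilde u_H^\ell\in V_H$ is the computed coarse state (not required to solve the coarse problem exactly); the segment $\widetilde u_H^\ell+s(\Pi_Hu_h-\widetilde u_H^\ell)$, $0\le s\le1$, lies in $\mathcal U_H$; and $u_h$, $\widetilde u_{\mathrm{ms}}^\ell$, $\widetilde M_h^\ell(\Pi_Hu_h)$ lie in $\mathcal U_h$. *)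

theory Defs
  imports "HOL-Analysis.Analysis"
begin

section \<open>Domain, meshes and finite element spaces\<close>

text \<open>Open connected bounded sets whose boundary consists of finitely many flat facets: polygonal
  domains in dimension 2, polyhedral domains in dimension 3.\<close>

definition polyhedral_domain :: "'a::euclidean_space set \<Rightarrow> bool" where
  "polyhedral_domain \<Omega> \<longleftrightarrow>
     (DIM('a) = 2 \<or> DIM('a) = 3) \<and> open \<Omega> \<and> connected \<Omega> \<and> bounded \<Omega> \<and> \<Omega> \<noteq> {} \<and>
     (\<exists>\<F>. finite \<F> \<and> (\<forall>F\<in>\<F>. polytope F \<and> aff_dim F = int DIM('a) - 1) \<and> frontier \<Omega> = \<Union>\<F>)"

text \<open>The library's \<^const>\<open>triangulation\<close> contributes finiteness and the face-to-face condition.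
  Elements are closed simplices of full dimension.\<close>

definition mesh_of :: "'a::euclidean_space set \<Rightarrow> 'a set set \<Rightarrow> bool" where
  "mesh_of \<Omega> \<T> \<longleftrightarrow>
     triangulation \<T> \<and> (\<forall>K\<in>\<T>. int DIM('a) simplex K \<and> interior K \<subseteq> \<Omega>) \<and> \<Union>\<T> = closure \<Omega>"

definition mesh_refines :: "'a set set \<Rightarrow> 'a set set \<Rightarrow> bool" where
  "mesh_refines \<T>h \<T>H \<longleftrightarrow> (\<forall>K\<in>\<T>h. \<exists>K'\<in>\<T>H. K \<subseteq> K')"

definition inradius :: "'a::euclidean_space set \<Rightarrow> real" where
  "inradius K = Sup {r. 0 \<le> r \<and> (\<exists>x. cball x r \<subseteq> K)}"

definition shape_regular :: "real \<Rightarrow> 'a::euclidean_space set set \<Rightarrow> bool" where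
  "shape_regular \<sigma> \<T> \<longleftrightarrow> (\<forall>K\<in>\<T>. diameter K \<le> \<sigma> * inradius K)"

definition quasi_uniform :: "real \<Rightarrow> 'a::euclidean_space set set \<Rightarrow> bool" where
  "quasi_uniform \<rho> \<T> \<longleftrightarrow> (\<forall>K\<in>\<T>. \<forall>K'\<in>\<T>. diameter K \<le> \<rho> * diameter K')"

text \<open>Finite element functions vanish on the boundary and are identified with their continuous
  extensions by zero to the whole space. Being bounded and continuous, they live in the normed
  space \<^typ>\<open>'a \<Rightarrow>\<^sub>C real\<close>. Its (supremum) norm is not the energy norm; it only supplies the
  topology for Frechet derivatives, which on finite-dimensional spaces do not depend on the norm.\<close>

definition p1_space :: "'a::euclidean_space set \<Rightarrow> 'a set set \<Rightarrow> ('a \<Rightarrow>\<^sub>C real) set" where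
  "p1_space \<Omega> \<T> =
     {v. (\<forall>K\<in>\<T>. \<exists>a b. \<forall>x\<in>K. apply_bcontfun v x = a \<bullet> x + b) \<and>
         (\<forall>x. x \<notin> \<Omega> \<longrightarrow> apply_bcontfun v x = 0)}"

definition is_basis :: "'v::real_vector set \<Rightarrow> 'v set \<Rightarrow> bool" where
  "is_basis B V \<longleftrightarrow> finite B \<and> independent B \<and> span B = V"

section \<open>Forms, norms and residual\<close>

definition linear_over :: "'v::real_vector set \<Rightarrow> ('v \<Rightarrow> 'w::real_vector) \<Rightarrow> bool" where
  "linear_over V f \<longleftrightarrow>
     (\<forall>x\<in>V. \<forall>y\<in>V. \<forall>c d. f (c *\<^sub>R x + d *\<^sub>R y) = c *\<^sub>R f x + d *\<^sub>R f y)"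

definition energy_form :: "'v::real_vector set \<Rightarrow> ('v \<Rightarrow> 'v \<Rightarrow> real) \<Rightarrow> bool" where
  "energy_form V a \<longleftrightarrow>
     (\<forall>v\<in>V. linear_over V (a v)) \<and> (\<forall>v\<in>V. \<forall>w\<in>V. a v w = a w v) \<and>
     (\<forall>v\<in>V. v \<noteq> 0 \<longrightarrow> 0 < a v v)"

definition energy_norm :: "('v \<Rightarrow> 'v \<Rightarrow> real) \<Rightarrow> 'v \<Rightarrow> real" where
  "energy_norm a v = sqrt (a v v)"

text \<open>Inserting \<open>0\<close> only fixes the supremum over the empty set when \<open>V = {0}\<close>, as all quotients
  are nonnegative.\<close>

definition dual_norm :: "('v::real_vector \<Rightarrow> real) \<Rightarrow> 'v set \<Rightarrow> ('v \<Rightarrow> real) \<Rightarrow> real" where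
  "dual_norm nrm V F = Sup (insert 0 {\<bar>F v\<bar> / nrm v | v. v \<in> V - {0}})"

definition residual ::
  "('v \<Rightarrow> 'v \<Rightarrow> real) \<Rightarrow> ('v \<Rightarrow> real) \<Rightarrow> 'v \<Rightarrow> 'v \<Rightarrow> real" where
  "residual A L z w = L w - A z w"

section \<open>Ideal reconstruction\<close>

definition fine_space :: "'v set \<Rightarrow> ('v \<Rightarrow> 'v::zero) \<Rightarrow> 'v set" where
  "fine_space Vh \<Pi>H = {v \<in> Vh. \<Pi>H v = 0}"

text \<open>Used for the ideal correction, with test space \<open>V\<^sub>f\<close>, and for the local ones.\<close>

definition is_correction ::
  "('v::plus \<Rightarrow> 'v \<Rightarrow> real) \<Rightarrow> ('v \<Rightarrow> real) \<Rightarrow> 'v set \<Rightarrow> 'v \<Rightarrow> 'v \<Rightarrow> bool" where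
  "is_correction A L W vH v \<longleftrightarrow> v \<in> W \<and> (\<forall>w\<in>W. A (vH + v) w = L w)"

definition ideal_reconstruction ::
  "('v::plus \<Rightarrow> 'v \<Rightarrow> real) \<Rightarrow> ('v \<Rightarrow> real) \<Rightarrow> 'v set \<Rightarrow> 'v \<Rightarrow> 'v" where
  "ideal_reconstruction A L Vf vH = vH + (THE v. is_correction A L Vf vH v)"

section \<open>Patches and local corrections\<close>

definition fun_support :: "('a::topological_space \<Rightarrow> real) \<Rightarrow> 'a set" where
  "fun_support f = closure {x. f x \<noteq> 0}"

text \<open>The functions are given on \<^term>\<open>closure \<Omega>\<close> and set to zero elsewhere.\<close>

definition coarse_partition_of_unity ::
  "'a::euclidean_space set \<Rightarrow> 'a set set \<Rightarrow> 'i set \<Rightarrow> ('i \<Rightarrow> 'a \<Rightarrow> real) \<Rightarrow> bool" where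
  "coarse_partition_of_unity \<Omega> \<T>H I \<phi> \<longleftrightarrow>
     finite I \<and>
     (\<forall>i\<in>I. continuous_on (closure \<Omega>) (\<phi> i) \<and> (\<forall>x. 0 \<le> \<phi> i x) \<and>
            (\<forall>x. x \<notin> closure \<Omega> \<longrightarrow> \<phi> i x = 0) \<and>
            (\<exists>S\<subseteq>\<T>H. fun_support (\<phi> i) = \<Union>S)) \<and>
     (\<forall>x\<in>closure \<Omega>. (\<Sum>i\<in>I. \<phi> i x) = 1)"

primrec patch :: "'a::euclidean_space set set \<Rightarrow> ('a \<Rightarrow> real) \<Rightarrow> nat \<Rightarrow> 'a set" where
  "patch \<T>H f 0 = interior (fun_support f)"
| "patch \<T>H f (Suc l) =
     interior (closure (patch \<T>H f l) \<union> \<Union>{K\<in>\<T>H. K \<inter> closure (patch \<T>H f l) \<noteq> {}})"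

text \<open>Coefficient vectors on a set \<open>\<omega>\<close> are functions on the basis elements whose support meets
  \<open>\<omega>\<close>, with value \<^const>\<open>undefined\<close> on the others.\<close>

definition active_basis ::
  "('a::euclidean_space \<Rightarrow>\<^sub>C real) set \<Rightarrow> 'a set \<Rightarrow> ('a \<Rightarrow>\<^sub>C real) set" where
  "active_basis B \<omega> = {b\<in>B. fun_support (apply_bcontfun b) \<inter> \<omega> \<noteq> {}}"

definition patch_coeffs ::
  "('a::euclidean_space \<Rightarrow>\<^sub>C real) set \<Rightarrow> 'a set \<Rightarrow> ('a \<Rightarrow>\<^sub>C real) \<Rightarrow> ('a \<Rightarrow>\<^sub>C real) \<Rightarrow> real" where
  "patch_coeffs B \<omega> v = restrict (representation B v) (active_basis B \<omega>)"

definition patch_fine_space ::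
  "('a::euclidean_space \<Rightarrow>\<^sub>C real) set \<Rightarrow> 'a set \<Rightarrow> ('a \<Rightarrow>\<^sub>C real) set" where
  "patch_fine_space Vf \<omega> =
     {v\<in>Vf. fun_support (apply_bcontfun v) \<subseteq> closure \<omega> \<and>
            (\<forall>x\<in>frontier \<omega>. apply_bcontfun v x = 0)}"

text \<open>\<open>A\<omega>\<close>, \<open>L\<omega>\<close> are restrictions of \<open>A\<close>, \<open>L\<close> to \<open>\<omega>\<close>: for integral forms, integrals over \<open>\<omega>\<close>
  instead of \<open>\<Omega>\<close>. They see the first argument only on \<open>\<omega>\<close> and agree with \<open>A\<close>, \<open>L\<close> on test
  functions vanishing outside \<open>\<omega>\<close>; these are the only test functions needed.\<close>

definition patch_restriction ::
  "('a::euclidean_space \<Rightarrow>\<^sub>C real) set \<Rightarrow> 'a set \<Rightarrow>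
   (('a \<Rightarrow>\<^sub>C real) \<Rightarrow> ('a \<Rightarrow>\<^sub>C real) \<Rightarrow> real) \<Rightarrow> (('a \<Rightarrow>\<^sub>C real) \<Rightarrow> real) \<Rightarrow>
   (('a \<Rightarrow>\<^sub>C real) \<Rightarrow> ('a \<Rightarrow>\<^sub>C real) \<Rightarrow> real) \<Rightarrow> (('a \<Rightarrow>\<^sub>C real) \<Rightarrow> real) \<Rightarrow> bool" where
  "patch_restriction Vh \<omega> A L A\<omega> L\<omega> \<longleftrightarrow>
     (\<forall>w\<in>Vh. (\<forall>x. x \<notin> \<omega> \<longrightarrow> apply_bcontfun w x = 0) \<longrightarrow>
        L\<omega> w = L w \<and> (\<forall>v\<in>Vh. A\<omega> v w = A v w) \<and>
        (\<forall>v\<in>Vh. \<forall>v'\<in>Vh. (\<forall>x\<in>\<omega>. apply_bcontfun v x = apply_bcontfun v' x) \<longrightarrow>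
           A\<omega> v w = A\<omega> v' w))"

text \<open>The local correction as a function of the coefficient vector \<open>p\<close>. By locality the choice of
  \<open>vH\<close> among the coarse functions with coefficients \<open>p\<close> on the patch is immaterial.\<close>

definition local_correction ::
  "('a::euclidean_space \<Rightarrow>\<^sub>C real) set \<Rightarrow> ('a \<Rightarrow>\<^sub>C real) set \<Rightarrow> ('a \<Rightarrow>\<^sub>C real) set \<Rightarrow> 'a set \<Rightarrow>
   (('a \<Rightarrow>\<^sub>C real) \<Rightarrow> ('a \<Rightarrow>\<^sub>C real) \<Rightarrow> real) \<Rightarrow> (('a \<Rightarrow>\<^sub>C real) \<Rightarrow> real) \<Rightarrow>
   (('a \<Rightarrow>\<^sub>C real) \<Rightarrow> real) \<Rightarrow> ('a \<Rightarrow>\<^sub>C real)" where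
  "local_correction VH BH Vf \<omega> A\<omega> L\<omega> p =
     (THE v. \<exists>vH\<in>VH. patch_coeffs BH \<omega> vH = p \<and>
                     is_correction A\<omega> L\<omega> (patch_fine_space Vf \<omega>) vH v)"

section \<open>Computable reconstruction\<close>

text \<open>Local functions on \<open>\<omega>\<close> are \<^const>\<open>undefined\<close> outside \<open>\<omega>\<close>, as produced by \<^const>\<open>restrict\<close>.\<close>

definition ext_by_zero :: "'a set \<Rightarrow> ('a \<Rightarrow> real) \<Rightarrow> 'a \<Rightarrow> real" where
  "ext_by_zero \<omega> g = (\<lambda>x. if x \<in> \<omega> then g x else 0)"

definition fe_of_coeffs ::
  "('a::euclidean_space \<Rightarrow>\<^sub>C real) set \<Rightarrow> 'a set \<Rightarrow> (('a \<Rightarrow>\<^sub>C real) \<Rightarrow> real) \<Rightarrow> 'a \<Rightarrow> real" where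
  "fe_of_coeffs Bh \<omega> c = restrict (apply_bcontfun (\<Sum>\<psi>\<in>active_basis Bh \<omega>. c \<psi> *\<^sub>R \<psi>)) \<omega>"

definition blend ::
  "'a::euclidean_space set set \<Rightarrow> 'i set \<Rightarrow> ('i \<Rightarrow> 'a \<Rightarrow> real) \<Rightarrow> ('i \<Rightarrow> 'a \<Rightarrow> real) \<Rightarrow> 'a \<Rightarrow> real"
  where
  "blend \<T>H I \<phi> g = (\<lambda>x. \<Sum>i\<in>I. \<phi> i x * ext_by_zero (patch \<T>H (\<phi> i) 0) (g i) x)"

text \<open>Blended functions need not be finite element functions. The following space contains them,
  for all local functions that are restrictions of fine finite element functions, together with
  the fine finite element space itself.\<close>

definition blend_space ::
  "('a::euclidean_space \<Rightarrow>\<^sub>C real) set \<Rightarrow> 'a set set \<Rightarrow> 'i set \<Rightarrow> ('i \<Rightarrow> 'a \<Rightarrow> real) \<Rightarrow>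
   ('a \<Rightarrow> real) set" where
  "blend_space Vh \<T>H I \<phi> =
     {(\<lambda>x. apply_bcontfun v x +
           blend \<T>H I \<phi> (\<lambda>i. restrict (apply_bcontfun (w i)) (patch \<T>H (\<phi> i) 0)) x) | v w.
      v \<in> Vh \<and> (\<forall>i\<in>I. w i \<in> Vh)}"

text \<open>Interpolation and projection both reproduce \<open>Vh\<close>. Stability is in the supremum norm, which
  is the norm of \<^typ>\<open>'a \<Rightarrow>\<^sub>C real\<close>.\<close>

definition fine_interpolation ::
  "real \<Rightarrow> ('a::euclidean_space \<Rightarrow>\<^sub>C real) set \<Rightarrow> ('a \<Rightarrow> real) set \<Rightarrow>
   (('a \<Rightarrow> real) \<Rightarrow> ('a \<Rightarrow>\<^sub>C real)) \<Rightarrow> bool" where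
  "fine_interpolation C Vh X Ih \<longleftrightarrow>
     (\<forall>f\<in>X. Ih f \<in> Vh) \<and>
     (\<forall>f\<in>X. \<forall>g\<in>X. \<forall>c d. Ih (\<lambda>x. c * f x + d * g x) = c *\<^sub>R Ih f + d *\<^sub>R Ih g) \<and>
     (\<forall>v\<in>Vh. Ih (apply_bcontfun v) = v) \<and>
     (\<forall>f\<in>X. \<forall>k. (\<forall>x. \<bar>f x\<bar> \<le> k) \<longrightarrow> norm (Ih f) \<le> C * k)"

text \<open>\<open>g i\<close> maps a coefficient vector on the patch of order \<open>l\<close> to a function on the patch of
  order 0.\<close>

definition computable_reconstruction ::
  "(('a::euclidean_space \<Rightarrow>\<^sub>C real) \<Rightarrow> ('a \<Rightarrow>\<^sub>C real)) \<Rightarrow> (('a \<Rightarrow> real) \<Rightarrow> ('a \<Rightarrow>\<^sub>C real)) \<Rightarrow>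
   'a set set \<Rightarrow> ('a \<Rightarrow>\<^sub>C real) set \<Rightarrow> 'i set \<Rightarrow> ('i \<Rightarrow> 'a \<Rightarrow> real) \<Rightarrow> nat \<Rightarrow>
   ('i \<Rightarrow> (('a \<Rightarrow>\<^sub>C real) \<Rightarrow> real) \<Rightarrow> 'a \<Rightarrow> real) \<Rightarrow> ('a \<Rightarrow>\<^sub>C real) \<Rightarrow> ('a \<Rightarrow>\<^sub>C real)" where
  "computable_reconstruction \<Pi>H Ih \<T>H BH I \<phi> l g vH =
     (let w = Ih (blend \<T>H I \<phi> (\<lambda>i. g i (patch_coeffs BH (patch \<T>H (\<phi> i) l) vH)))
      in vH + (w - \<Pi>H w))"

text \<open>Derivative of a map on the coarse space. \<^const>\<open>frechet_derivative\<close> selects an extension to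
  the whole type, but its values on directions in \<open>VH\<close> are uniquely determined.\<close>

definition coarse_deriv ::
  "'v::real_normed_vector set \<Rightarrow> ('v \<Rightarrow> 'v) \<Rightarrow> 'v \<Rightarrow> 'v \<Rightarrow> 'v" where
  "coarse_deriv VH M vH = frechet_derivative M (at vH within VH)"

definition reduced_residual ::
  "('v::real_normed_vector \<Rightarrow> 'v \<Rightarrow> real) \<Rightarrow> ('v \<Rightarrow> real) \<Rightarrow> 'v set \<Rightarrow> ('v \<Rightarrow> 'v) \<Rightarrow> 'v \<Rightarrow> 'v \<Rightarrow> real"
  where
  "reduced_residual A L VH M wH \<xi> = residual A L (M wH) (coarse_deriv VH M wH \<xi>)"

end

theory Submission
  imports Defs
begin

text \<open>Write \<open>d = \<Pi>\<^sub>H u\<^sub>h - u\<^sub>H\<close>. As \<open>\<Pi>\<^sub>H\<close> is a left inverse of the computable reconstruction,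
  \<open>d = \<Pi>\<^sub>H e\<^sub>h\<close>, and as \<open>u\<^sub>h = M\<^sub>h (\<Pi>\<^sub>H u\<^sub>h)\<close>, the error splits as \<open>e\<^sub>h = e\<^sub>l\<^sub>o\<^sub>c + DM(u\<^sub>H)[d] + r\<close>
  with a Taylor remainder \<open>r\<close> that is quadratic in \<open>d\<close>. Strong monotonicity bounds
  \<open>m\<^sub>A \<parallel>e\<^sub>h\<parallel>\<^sup>2\<close> by the residual at \<open>e\<^sub>h\<close>. On the first summand the residual is controlled by
  Lipschitz continuity, on the second it is the reduced residual, and on the third it is at most
  \<open>\<gamma> \<parallel>e\<^sub>h\<parallel>\<^sup>3\<close>, which the smallness assumption absorbs into half of the left-hand side. Finite
  dimensionality makes the dual norms genuine suprema, places \<open>DM(u\<^sub>H)[d]\<close> in the fine space and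
  makes the residual continuous, so that it can be differentiated along the segment.\<close>

section \<open>Linear maps on subspaces\<close>

lemma linear_over_add:
  assumes "linear_over V f" "x \<in> V" "y \<in> V"
  shows "f (x + y) = f x + f y"
proof -
  have "f (1 *\<^sub>R x + 1 *\<^sub>R y) = 1 *\<^sub>R f x + 1 *\<^sub>R f y"
    using assms unfolding linear_over_def by blast
  then show ?thesis by simp
qed

lemma linear_over_diff:
  assumes "linear_over V f" "x \<in> V" "y \<in> V"
  shows "f (x - y) = f x - f y"
proof -
  have "f (1 *\<^sub>R x + (-1) *\<^sub>R y) = 1 *\<^sub>R f x + (-1) *\<^sub>R f y"
    using assms unfolding linear_over_def by blast
  then show ?thesis by simp
qed

lemma linear_over_scale:
  assumes "linear_over V f" "x \<in> V"
  shows "f (c *\<^sub>R x) = c *\<^sub>R f x"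
proof -
  have "f (c *\<^sub>R x + 0 *\<^sub>R x) = c *\<^sub>R f x + 0 *\<^sub>R f x"
    using assms unfolding linear_over_def by blast
  then show ?thesis by simp
qed

lemma linear_over_subset: "linear_over V f \<Longrightarrow> W \<subseteq> V \<Longrightarrow> linear_over W f"
  unfolding linear_over_def by blast

lemma linear_over_diff_fun:
  assumes "linear_over V f" "linear_over V g"
  shows "linear_over V (\<lambda>x. f x - g x)"
  using assms unfolding linear_over_def by (simp add: algebra_simps)

text \<open>Dividing by \<open>c\<close> turns the right-hand side into the distance from
  \<open>b\<close> to a point of \<open>V\<close>. For closed \<open>V\<close> not containing
  \<open>b\<close> this bounds the \<open>b\<close>-coordinate of a vector by its norm, which drives
  the next two inductions.\<close>

lemma infdist_scale_le_norm:
  fixes b :: "'v::real_normed_vector"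
  assumes "subspace V" "v \<in> V"
  shows "\<bar>c\<bar> * infdist b V \<le> norm (c *\<^sub>R b + v)"
proof (cases "c = 0")
  case False
  have "- (inverse c *\<^sub>R v) \<in> V"
    using assms by (simp add: subspace_neg subspace_scale)
  then have "infdist b V \<le> norm (b + inverse c *\<^sub>R v)"
    using infdist_le[of "- (inverse c *\<^sub>R v)" V b] by (simp add: dist_norm)
  then have "\<bar>c\<bar> * infdist b V \<le> norm (c *\<^sub>R (b + inverse c *\<^sub>R v))"
    by (simp add: mult_left_mono)
  then show ?thesis using False by (simp add: scaleR_add_right)
qed auto

lemma closed_span_finite:
  fixes B :: "'v::real_normed_vector set"
  assumes "finite B"
  shows "closed (span B)"
  using assms
proof induction
  case (insert b B)
  show ?case
  proof (cases "b \<in> span B")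
    case True
    then show ?thesis using insert.IH by (simp add: span_redundant)
  next
    case False
    \<comment> \<open>Positive because \<open>span B\<close> is closed by the induction hypothesis
      and misses \<open>b\<close>.\<close>
    define \<delta> where "\<delta> = infdist b (span B)"
    have "span B \<noteq> {}" using span_zero by blast
    then have \<delta>: "\<delta> > 0"
      using False insert.IH in_closed_iff_infdist_zero[of "span B" b] infdist_nonneg[of b "span B"]
      unfolding \<delta>_def by linarith
    show ?thesis
      unfolding closed_sequential_limits
    proof (intro allI impI)
      fix x l assume x: "(\<forall>n. x n \<in> span (insert b B)) \<and> x \<longlonglongrightarrow> l"
      have "\<forall>n. \<exists>k. x n - k *\<^sub>R b \<in> span B" using x by (simp add: span_breakdown_eq)
      then obtain c where c: "\<And>n. x n - c n *\<^sub>R b \<in> span B" by metis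
      \<comment> \<open>The \<open>b\<close>-coordinates inherit the Cauchy property from
        \<open>x\<close>; subtracting their limit leaves a convergent sequence in the closed set
        \<open>span B\<close>.\<close>
      have gap: "\<bar>c m - c n\<bar> \<le> dist (x m) (x n) / \<delta>" for m n
      proof -
        have "(x m - c m *\<^sub>R b) - (x n - c n *\<^sub>R b) \<in> span B" by (intro span_diff c)
        from infdist_scale_le_norm[OF subspace_span this, of "c m - c n" b]
        have "\<bar>c m - c n\<bar> * \<delta> \<le> dist (x m) (x n)"
          unfolding \<delta>_def dist_norm by (simp add: algebra_simps)
        then show ?thesis using \<delta> by (simp add: field_simps)
      qed
      have "Cauchy c"
      proof (rule metric_CauchyI)
        fix e :: real assume "0 < e"
        then have "0 < e * \<delta>" using \<delta> by simp
        then obtain N where "\<forall>m\<ge>N. \<forall>n\<ge>N. dist (x m) (x n) < e * \<delta>"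
          using x LIMSEQ_imp_Cauchy metric_CauchyD by blast
        then have "\<forall>m\<ge>N. \<forall>n\<ge>N. dist (x m) (x n) / \<delta> < e" using \<delta> by (simp add: field_simps)
        then show "\<exists>M. \<forall>m\<ge>M. \<forall>n\<ge>M. dist (c m) (c n) < e"
          using gap unfolding dist_real_def by (meson le_less_trans)
      qed
      then obtain k where "c \<longlonglongrightarrow> k" using real_Cauchy_convergent convergentD by blast
      then have "(\<lambda>n. x n - c n *\<^sub>R b) \<longlonglongrightarrow> l - k *\<^sub>R b"
        using x by (intro tendsto_diff tendsto_scaleR tendsto_const) simp_all
      then have "l - k *\<^sub>R b \<in> span B"
        by (rule closed_sequentially[OF insert.IH c])
      then show "l \<in> span (insert b B)" by (auto simp: span_breakdown_eq)
    qed
  qed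
qed simp

text \<open>Induction on the generators: split off the \<open>b\<close>-coordinate, which is at most
  \<open>norm v / \<delta>\<close> with \<open>\<delta>\<close> the distance from \<open>b\<close>
  to \<open>span B\<close>. The remainder lies in \<open>span B\<close> and falls to the induction
  hypothesis.\<close>

lemma linear_over_span_bounded:
  fixes B :: "'v::real_normed_vector set" and F :: "'v \<Rightarrow> 'w::real_normed_vector"
  assumes "finite B" "linear_over (span B) F"
  shows "\<exists>C. \<forall>v\<in>span B. norm (F v) \<le> C * norm v"
  using assms
proof induction
  case empty
  have "F 0 = 0" using linear_over_scale[OF empty, of 0 0] by simp
  then show ?case by simp
next
  case (insert b B)
  note lin = insert.prems
  have sub: "span B \<subseteq> span (insert b B)" by (rule span_mono) blast
  then obtain C where C: "\<And>v. v \<in> span B \<Longrightarrow> norm (F v) \<le> C * norm v"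
    using insert.IH linear_over_subset[OF lin] by blast
  show ?case
  proof (cases "b \<in> span B")
    case True
    then show ?thesis using C by (auto simp: span_redundant)
  next
    case False
    define \<delta> where "\<delta> = infdist b (span B)"
    have "span B \<noteq> {}" using span_zero by blast
    then have \<delta>: "\<delta> > 0"
      using False closed_span_finite[OF insert.hyps(1)] in_closed_iff_infdist_zero[of "span B" b]
        infdist_nonneg[of b "span B"]
      unfolding \<delta>_def by linarith
    define D where "D = norm (F b) / \<delta> + \<bar>C\<bar> * (1 + norm b / \<delta>)"
    have "norm (F v) \<le> D * norm v" if v: "v \<in> span (insert b B)" for v
    proof -
      obtain c where c: "v - c *\<^sub>R b \<in> span B" using v by (auto simp: span_breakdown_eq)
      have b: "b \<in> span (insert b B)" by (simp add: span_base)
      have "F v = F (c *\<^sub>R b + (v - c *\<^sub>R b))" by simp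
      also have "\<dots> = c *\<^sub>R F b + F (v - c *\<^sub>R b)"
        using linear_over_add[OF lin span_scale[OF b]] linear_over_scale[OF lin b] c sub
        by (metis subsetD)
      finally have "norm (F v) \<le> \<bar>c\<bar> * norm (F b) + norm (F (v - c *\<^sub>R b))"
        using norm_triangle_ineq by (metis norm_scaleR)
      moreover have "norm (F (v - c *\<^sub>R b)) \<le> \<bar>C\<bar> * norm (v - c *\<^sub>R b)"
        using C[OF c] by (meson abs_ge_self mult_right_mono norm_ge_zero order_trans)
      moreover have "\<bar>C\<bar> * norm (v - c *\<^sub>R b) \<le> \<bar>C\<bar> * (norm v + \<bar>c\<bar> * norm b)"
        using norm_triangle_ineq4[of v "c *\<^sub>R b"] by (intro mult_left_mono) auto
      moreover have cb: "\<bar>c\<bar> \<le> norm v / \<delta>"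
        using infdist_scale_le_norm[OF subspace_span c, of c b] \<delta>
        unfolding \<delta>_def by (simp add: field_simps)
      moreover have "\<bar>c\<bar> * norm (F b) \<le> norm v / \<delta> * norm (F b)"
        using cb by (intro mult_right_mono) auto
      moreover have "\<bar>C\<bar> * (norm v + \<bar>c\<bar> * norm b) \<le> \<bar>C\<bar> * (norm v + norm v / \<delta> * norm b)"
        using cb by (intro mult_left_mono add_left_mono mult_right_mono) auto
      ultimately have "norm (F v) \<le>
          norm v / \<delta> * norm (F b) + \<bar>C\<bar> * (norm v + norm v / \<delta> * norm b)"
        by linarith
      also have "\<dots> = D * norm v" unfolding D_def by (simp add: algebra_simps)
      finally show ?thesis .
    qed
    then show ?thesis by blast
  qed
qed

text \<open>\<open>F\<close> is linear on \<open>span B\<close> only, so continuity is available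
  only along filters that eventually stay there; the bound is applied to
  \<open>f x - l\<close>.\<close>

lemma linear_over_span_tendsto:
  fixes B :: "'v::real_normed_vector set" and F :: "'v \<Rightarrow> 'w::real_normed_vector"
  assumes B: "finite B" and lin: "linear_over (span B) F"
    and f: "(f \<longlongrightarrow> l) X" and fB: "eventually (\<lambda>x. f x \<in> span B) X" and l: "l \<in> span B"
  shows "((\<lambda>x. F (f x)) \<longlongrightarrow> F l) X"
proof -
  obtain C where C: "\<And>v. v \<in> span B \<Longrightarrow> norm (F v) \<le> C * norm v"
    using linear_over_span_bounded[OF B lin] by blast
  have "eventually (\<lambda>x. norm (F (f x) - F l) \<le> C * norm (f x - l)) X"
    using fB by eventually_elim (metis C linear_over_diff[OF lin] l span_diff)
  moreover have "((\<lambda>x. C * norm (f x - l)) \<longlongrightarrow> 0) X"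
    using f by (intro tendsto_mult_right_zero tendsto_norm_zero LIM_zero)
  ultimately have "((\<lambda>x. F (f x) - F l) \<longlongrightarrow> 0) X" by (rule Lim_null_comparison)
  then show ?thesis by (rule LIM_zero_cancel)
qed

section \<open>Energy norm and dual norm\<close>

lemma energy_form_linear: "energy_form V a \<Longrightarrow> v \<in> V \<Longrightarrow> linear_over V (a v)"
  by (simp add: energy_form_def)

lemma energy_form_sym: "energy_form V a \<Longrightarrow> v \<in> V \<Longrightarrow> w \<in> V \<Longrightarrow> a v w = a w v"
  by (simp add: energy_form_def)

lemma energy_form_nonneg:
  assumes "energy_form V a" "subspace V" "v \<in> V"
  shows "0 \<le> a v v"
proof (cases "v = 0")
  case True
  then have "a v v = 0"
    using linear_over_scale[OF energy_form_linear[OF assms(1,3)] assms(3), of 0] by simp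
  then show ?thesis by simp
next
  case False
  then show ?thesis using assms unfolding energy_form_def by (simp add: less_imp_le)
qed

lemma energy_norm_nonneg:
  "energy_form V a \<Longrightarrow> subspace V \<Longrightarrow> v \<in> V \<Longrightarrow> 0 \<le> energy_norm a v"
  by (simp add: energy_norm_def energy_form_nonneg)

lemma energy_norm_pos:
  "energy_form V a \<Longrightarrow> v \<in> V \<Longrightarrow> v \<noteq> 0 \<Longrightarrow> 0 < energy_norm a v"
  by (simp add: energy_norm_def energy_form_def)

lemma energy_form_scale:
  assumes "energy_form V a" "subspace V" "v \<in> V"
  shows "a (c *\<^sub>R v) (c *\<^sub>R v) = c\<^sup>2 * a v v"
proof -
  note lin = energy_form_linear[OF assms(1)]
  have cv: "c *\<^sub>R v \<in> V" using assms by (simp add: subspace_scale)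
  have "a (c *\<^sub>R v) (c *\<^sub>R v) = c * a (c *\<^sub>R v) v"
    using linear_over_scale[OF lin[OF cv] assms(3)] by simp
  also have "a (c *\<^sub>R v) v = a v (c *\<^sub>R v)" using assms(1) cv assms(3) by (rule energy_form_sym)
  also have "a v (c *\<^sub>R v) = c * a v v"
    using linear_over_scale[OF lin[OF assms(3)] assms(3)] by simp
  finally show ?thesis by (simp add: power2_eq_square)
qed

lemma energy_norm_scale:
  assumes "energy_form V a" "subspace V" "v \<in> V"
  shows "energy_norm a (c *\<^sub>R v) = \<bar>c\<bar> * energy_norm a v"
  by (simp add: energy_norm_def energy_form_scale[OF assms] real_sqrt_mult)

lemma energy_form_subset: "energy_form V a \<Longrightarrow> W \<subseteq> V \<Longrightarrow> energy_form W a"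
  unfolding energy_form_def by (meson linear_over_subset subsetD)

lemma energy_form_diff_expand:
  assumes en: "energy_form V a" and V: "subspace V" and "v \<in> V" "w \<in> V"
  shows "a (v - w) (v - w) = a v v - 2 * a v w + a w w"
proof -
  have l: "linear_over V (a x)" and s: "a x y = a y x" if "x \<in> V" "y \<in> V" for x y
    using energy_form_linear[OF en] energy_form_sym[OF en] that by blast+
  have d: "v - w \<in> V" using assms by (simp add: subspace_diff)
  have "a (v - w) (v - w) = a v (v - w) - a w (v - w)"
    using linear_over_diff[OF l[OF d d] assms(3,4)] s d assms by metis
  also have "\<dots> = (a v v - a v w) - (a v w - a w w)"
    using linear_over_diff[OF l assms(3,4)] s assms by metis
  finally show ?thesis by simp
qed

lemma energy_cauchy_schwarz:
  assumes en: "energy_form V a" and V: "subspace V" and vw: "v \<in> V" "w \<in> V"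
  shows "\<bar>a v w\<bar> \<le> energy_norm a v * energy_norm a w"
proof (cases "w = 0")
  case True
  then have "a v w = 0"
    using linear_over_scale[OF energy_form_linear[OF en vw(1)] vw(2), of 0] by simp
  then show ?thesis using energy_norm_nonneg[OF en V] vw by simp
next
  case False
  then have pos: "0 < a w w" using en vw unfolding energy_form_def by blast
  \<comment> \<open>\<open>t\<close> minimises the energy of
    \<open>v - t *\<^sub>R w\<close>.\<close>
  define t where "t = a v w / a w w"
  have tw: "t *\<^sub>R w \<in> V" using V vw by (simp add: subspace_scale)
  have "0 \<le> a (v - t *\<^sub>R w) (v - t *\<^sub>R w)"
    using energy_form_nonneg[OF en V] subspace_diff[OF V vw(1) tw] by blast
  also have "\<dots> = a v v - 2 * a v (t *\<^sub>R w) + t\<^sup>2 * a w w"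
    by (simp add: energy_form_diff_expand[OF en V vw(1) tw] energy_form_scale[OF en V vw(2)])
  also have "a v (t *\<^sub>R w) = t * a v w"
    using linear_over_scale[OF energy_form_linear[OF en vw(1)] vw(2), of t] by simp
  also have "a v v - 2 * (t * a v w) + t\<^sup>2 * a w w = a v v - (a v w)\<^sup>2 / a w w"
    using pos unfolding t_def by (simp add: field_simps power2_eq_square)
  finally have "(a v w)\<^sup>2 \<le> a v v * a w w" using pos by (simp add: field_simps)
  then have "sqrt ((a v w)\<^sup>2) \<le> sqrt (a v v * a w w)" by (rule real_sqrt_le_mono)
  then show ?thesis by (simp add: energy_norm_def real_sqrt_mult)
qed

text \<open>A Riesz representer, together with Cauchy-Schwarz, bounds a functional in the energy
  norm directly, so no equivalence with the supremum norm has to be established.\<close>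

lemma energy_riesz:
  assumes "finite B" "energy_form (span B) a" "linear_over (span B) F"
  shows "\<exists>w\<in>span B. \<forall>v\<in>span B. F v = a w v"
  using assms
proof (induction arbitrary: F)
  case empty
  have "linear_over {0} (a 0)" using empty.prems(1) unfolding energy_form_def by simp
  then have "a 0 0 = 0" using linear_over_scale[of "{0}" "a 0" 0 0] by simp
  moreover have "F 0 = 0" using linear_over_scale[of "{0}" F 0 0] empty.prems(2) by simp
  ultimately show ?case by simp
next
  case (insert b B)
  let ?W = "span (insert b B)"
  have sub: "span B \<subseteq> ?W" by (rule span_mono) blast
  have en: "energy_form (span B) a" by (rule energy_form_subset[OF insert.prems(1) sub])
  show ?case
  proof (cases "b \<in> span B")
    case True
    then have eq: "?W = span B" by (rule span_redundant)
    show ?thesis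
      unfolding eq by (rule insert.IH[OF en linear_over_subset[OF insert.prems(2) sub]])
  next
    case False
    have lin: "linear_over ?W (a x)" if "x \<in> ?W" for x
      using insert.prems(1) that by (rule energy_form_linear)
    have sym: "a x y = a y x" if "x \<in> ?W" "y \<in> ?W" for x y
      using insert.prems(1) that by (rule energy_form_sym)
    have b: "b \<in> ?W" by (simp add: span_base)
    \<comment> \<open>The energy-orthogonal projection of \<open>b\<close> onto
      \<open>span B\<close>, as the representer of the functional \<open>a b\<close>.\<close>
    obtain p where p: "p \<in> span B" "\<And>v. v \<in> span B \<Longrightarrow> a b v = a p v"
      using insert.IH[OF en linear_over_subset[OF lin[OF b] sub]] by blast
    \<comment> \<open>Gram-Schmidt: \<open>q\<close> is orthogonal to \<^term>\<open>span B\<close>.\<close>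
    define q where "q = b - p"
    have pW: "p \<in> ?W" using p sub by blast
    then have q: "q \<in> ?W" unfolding q_def using b by (rule span_diff[rotated])
    have "q \<noteq> 0" using False p unfolding q_def by auto
    then have qq: "0 < a q q" using q insert.prems(1) by (simp add: energy_form_def)
    have orth: "a v q = 0" if "v \<in> span B" for v
    proof -
      have vW: "v \<in> ?W" using that sub by blast
      have "a v q = a v b - a v p" unfolding q_def by (rule linear_over_diff[OF lin[OF vW] b pW])
      then show ?thesis using p(2)[OF that] sym[OF vW b] sym[OF vW pW] by simp
    qed
    obtain w0 where w0: "w0 \<in> span B" "\<And>v. v \<in> span B \<Longrightarrow> F v = a w0 v"
      using insert.IH[OF en linear_over_subset[OF insert.prems(2) sub]] by blast
    have w0W: "w0 \<in> ?W" using w0 sub by blast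
    \<comment> \<open>Chosen so that \<open>a w q = F q\<close>: the part \<open>w0\<close> is
      orthogonal to \<open>q\<close>.\<close>
    define k where "k = F q / a q q"
    define w where "w = w0 + k *\<^sub>R q"
    have kq: "k *\<^sub>R q \<in> ?W" using q by (rule span_scale)
    have w: "w \<in> ?W" unfolding w_def using w0W kq by (rule span_add)
    have "F v = a w v" if v: "v \<in> ?W" for v
    proof -
      obtain c where c: "v - c *\<^sub>R b \<in> span B" using v by (auto simp: span_breakdown_eq)
      \<comment> \<open>Replacing \<open>b\<close> by \<open>q\<close> changes the remainder only by
        a multiple of \<open>p\<close>, so \<open>u\<close> stays in \<open>span B\<close>.\<close>
      define u where "u = v - c *\<^sub>R q"
      have "u = (v - c *\<^sub>R b) + c *\<^sub>R p" unfolding u_def q_def by (simp add: algebra_simps)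
      then have u: "u \<in> span B" using c p by (simp add: span_add span_scale)
      then have uW: "u \<in> ?W" using sub by blast
      have cq: "c *\<^sub>R q \<in> ?W" using q by (rule span_scale)
      have vdec: "v = c *\<^sub>R q + u" unfolding u_def by simp
      have wdec: "a w x = a w0 x + k * a q x" if x: "x \<in> ?W" for x
      proof -
        have "a w x = a x w0 + a x (k *\<^sub>R q)"
          unfolding w_def
          using linear_over_add[OF lin[OF x] w0W kq] sym[OF x w] unfolding w_def by simp
        then show ?thesis
          using linear_over_scale[OF lin[OF x] q, of k] sym[OF x w0W] sym[OF x q] by simp
      qed
      have "a w v = c * a w q + a w u"
        unfolding vdec using linear_over_add[OF lin[OF w] cq uW] linear_over_scale[OF lin[OF w] q]
        by simp
      also have "a w q = F q" using wdec[OF q] orth[OF w0(1)] qq unfolding k_def by simp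
      also have "a w u = F u"
        using wdec[OF uW] orth[OF u] sym[OF q uW] w0(2)[OF u] by simp
      also have "c * F q + F u = F v"
        unfolding vdec
        using linear_over_add[OF insert.prems(2) cq uW] linear_over_scale[OF insert.prems(2) q]
        by simp
      finally show ?thesis by simp
    qed
    then show ?thesis using w by blast
  qed
qed

text \<open>A real \<open>Sup\<close> is a least upper bound only for bounded sets; here the energy
  norm of the Riesz representer is an upper bound.\<close>

lemma dual_norm_bdd_above:
  assumes B: "finite B" and en: "energy_form (span B) a" and F: "linear_over (span B) F"
  shows "bdd_above (insert 0 {\<bar>F v\<bar> / energy_norm a v | v. v \<in> span B - {0}})"
proof -
  obtain w where w: "w \<in> span B" "\<And>v. v \<in> span B \<Longrightarrow> F v = a w v"
    using energy_riesz[OF B en F] by blast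
  have "\<bar>F v\<bar> / energy_norm a v \<le> energy_norm a w" if "v \<in> span B" "v \<noteq> 0" for v
    using energy_cauchy_schwarz[OF en subspace_span w(1) that(1)] energy_norm_pos[OF en that] w(2) that
    by (simp add: field_simps)
  then show ?thesis
    by (intro bdd_aboveI[of _ "energy_norm a w"])
      (auto intro: energy_norm_nonneg[OF en subspace_span w(1)])
qed

lemma dual_norm_bound:
  assumes "finite B" and en: "energy_form (span B) a" and "linear_over (span B) F"
    and v: "v \<in> span B"
  shows "\<bar>F v\<bar> \<le> dual_norm (energy_norm a) (span B) F * energy_norm a v"
proof (cases "v = 0")
  case True
  then have "F v = 0" "energy_norm a v = 0"
    using linear_over_scale[OF assms(3) v, of 0] energy_norm_scale[OF en subspace_span v, of 0]
    by auto
  then show ?thesis by simp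
next
  case False
  then have "\<bar>F v\<bar> / energy_norm a v \<le> dual_norm (energy_norm a) (span B) F"
    unfolding dual_norm_def using v by (intro cSup_upper dual_norm_bdd_above[OF assms(1-3)]) auto
  then show ?thesis using energy_norm_pos[OF en v False] by (simp add: field_simps)
qed

lemma dual_norm_nonneg:
  assumes "finite B" "energy_form (span B) a" "linear_over (span B) F"
  shows "0 \<le> dual_norm (energy_norm a) (span B) F"
  unfolding dual_norm_def by (intro cSup_upper dual_norm_bdd_above[OF assms]) auto

text \<open>Covers a trivial coarse space, where the stability bound of the projection does not
  determine the sign of its constant.\<close>

lemma dual_norm_zero_space: "V \<subseteq> {0} \<Longrightarrow> dual_norm nrm V F = 0"
proof -
  assume "V \<subseteq> {0}"
  then have "insert 0 {\<bar>F v\<bar> / nrm v | v. v \<in> V - {0}} = {0}" by blast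
  then show ?thesis unfolding dual_norm_def by (metis cSup_singleton)
qed

section \<open>Reconstructions\<close>

lemma p1_space_mono:
  assumes "mesh_refines \<T>h \<T>H"
  shows "p1_space \<Omega> \<T>H \<subseteq> p1_space \<Omega> \<T>h"
  using assms unfolding p1_space_def mesh_refines_def by (auto, meson subsetD)

lemma ideal_reconstruction_eqI:
  assumes "\<exists>!v. is_correction A L W vH v" "u - vH \<in> W" "\<And>w. w \<in> W \<Longrightarrow> A u w = L w"
  shows "ideal_reconstruction A L W vH = (u::'v::ab_group_add)"
proof -
  have "is_correction A L W vH (u - vH)" using assms(2,3) unfolding is_correction_def by simp
  then have "(THE v. is_correction A L W vH v) = u - vH" by (rule the1_equality[OF assms(1)])
  then show ?thesis unfolding ideal_reconstruction_def by simp
qed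

lemma open_patch: "open (patch \<T> f l)"
  by (cases l) auto

text \<open>At a point of the patch every inactive basis function vanishes, so only the shared
  coefficients contribute.\<close>

lemma patch_coeffs_eq_imp_eq_on:
  assumes B: "is_basis B V" and vw: "v \<in> V" "w \<in> V"
    and eq: "patch_coeffs B \<omega> v = patch_coeffs B \<omega> w" and x: "x \<in> \<omega>"
  shows "apply_bcontfun v x = apply_bcontfun w x"
proof -
  have fin: "finite B" and ind: "independent B" and sp: "span B = V"
    using B unfolding is_basis_def by auto
  have sum_apply: "apply_bcontfun (\<Sum>b\<in>S. c b *\<^sub>R b) x = (\<Sum>b\<in>S. c b * apply_bcontfun b x)"
    for S and c :: "('a \<Rightarrow>\<^sub>C real) \<Rightarrow> real"
    by (induction S rule: infinite_finite_induct) auto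
  have ev: "apply_bcontfun u x = (\<Sum>b\<in>B. representation B u b * apply_bcontfun b x)"
    if "u \<in> V" for u
  proof -
    have "u = (\<Sum>b\<in>B. representation B u b *\<^sub>R b)"
      using sum_representation_eq[OF ind, of u B] fin sp that by simp
    then show ?thesis using sum_apply by metis
  qed
  have "representation B v b * apply_bcontfun b x = representation B w b * apply_bcontfun b x"
    if "b \<in> B" for b
  proof (cases "b \<in> active_basis B \<omega>")
    case True
    then show ?thesis using fun_cong[OF eq, of b] unfolding patch_coeffs_def by simp
  next
    case False
    then have "x \<notin> fun_support (apply_bcontfun b)" using that x unfolding active_basis_def by blast
    then have "apply_bcontfun b x = 0"
      using closure_subset[of "{y. apply_bcontfun b y \<noteq> 0}"] unfolding fun_support_def by blast
    then show ?thesis by simp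
  qed
  then show ?thesis unfolding ev[OF vw(1)] ev[OF vw(2)] by (rule sum.cong[OF refl])
qed

text \<open>The definite description ranges over all coarse functions with the same patch
  coefficients, so uniqueness for each one separately does not suffice. Such functions agree on the
  patch, and the restricted form sees nothing else; hence they share one correction.\<close>

lemma local_correction_in_fine:
  assumes B: "is_basis B VH" and vH: "vH \<in> VH" and sub: "VH \<subseteq> Vh" and V: "subspace Vh"
    and Vf: "Vf \<subseteq> Vh" and op: "open \<omega>"
    and restr: "patch_restriction Vh \<omega> A L A\<omega> L\<omega>"
    and ex1: "\<And>v. v \<in> VH \<Longrightarrow> \<exists>!z. is_correction A\<omega> L\<omega> (patch_fine_space Vf \<omega>) v z"
  shows "local_correction VH B Vf \<omega> A\<omega> L\<omega> (patch_coeffs B \<omega> vH) \<in> Vf"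
proof -
  let ?W = "patch_fine_space Vf \<omega>"
  have indep: "is_correction A\<omega> L\<omega> ?W vH z"
    if v: "v \<in> VH" "patch_coeffs B \<omega> v = patch_coeffs B \<omega> vH" and z: "is_correction A\<omega> L\<omega> ?W v z"
    for v z
  proof -
    have zW: "z \<in> ?W" and zA: "\<And>w. w \<in> ?W \<Longrightarrow> A\<omega> (v + z) w = L\<omega> w"
      using z unfolding is_correction_def by auto
    have zh: "z \<in> Vh" using zW Vf unfolding patch_fine_space_def by blast
    have "A\<omega> (vH + z) w = L\<omega> w" if w: "w \<in> ?W" for w
    proof -
      have wh: "w \<in> Vh" using w Vf unfolding patch_fine_space_def by blast
      \<comment> \<open>The test functions must vanish off the patch for
        \<open>patch_restriction\<close> to apply. As the patch is open, an outside point lies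
        either on its frontier or outside its closure.\<close>
      have off: "apply_bcontfun w x = 0" if "x \<notin> \<omega>" for x
      proof (cases "x \<in> closure \<omega>")
        case True
        then have "x \<in> frontier \<omega>" using that op by (simp add: frontier_def interior_open)
        then show ?thesis using w unfolding patch_fine_space_def by blast
      next
        case False
        then have "x \<notin> fun_support (apply_bcontfun w)" using w unfolding patch_fine_space_def by blast
        then show ?thesis
          using closure_subset[of "{y. apply_bcontfun w y \<noteq> 0}"] unfolding fun_support_def by blast
      qed
      have "\<forall>x\<in>\<omega>. apply_bcontfun (vH + z) x = apply_bcontfun (v + z) x"
        using patch_coeffs_eq_imp_eq_on[OF B v(1) vH v(2)] by (simp add: plus_bcontfun.rep_eq)
      moreover have "vH + z \<in> Vh" "v + z \<in> Vh"
        using subspace_add[OF V] zh v vH sub by blast+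
      ultimately have "A\<omega> (vH + z) w = A\<omega> (v + z) w"
        using restr wh off unfolding patch_restriction_def by blast
      then show ?thesis using zA[OF w] by simp
    qed
    then show ?thesis using zW unfolding is_correction_def by blast
  qed
  have "\<exists>!z. \<exists>v\<in>VH. patch_coeffs B \<omega> v = patch_coeffs B \<omega> vH \<and> is_correction A\<omega> L\<omega> ?W v z"
    using ex1[OF vH] vH indep by metis
  from theI'[OF this] have "\<exists>v\<in>VH. is_correction A\<omega> L\<omega> ?W v
      (local_correction VH B Vf \<omega> A\<omega> L\<omega> (patch_coeffs B \<omega> vH))"
    unfolding local_correction_def by blast
  then show ?thesis unfolding is_correction_def patch_fine_space_def by blast
qed

lemma fe_of_coeffs_restrict:
  assumes "is_basis B V"
  shows "\<exists>w\<in>V. fe_of_coeffs B \<omega> c = restrict (apply_bcontfun w) \<omega>"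
proof -
  have "(\<Sum>\<psi>\<in>active_basis B \<omega>. c \<psi> *\<^sub>R \<psi>) \<in> span B"
    by (intro span_sum span_scale span_base) (simp add: active_basis_def)
  then show ?thesis using assms unfolding is_basis_def fe_of_coeffs_def by blast
qed

text \<open>Places the blended function in the set on which \<open>fine_interpolation\<close>
  controls the interpolant.\<close>

lemma blend_in_blend_space:
  assumes "0 \<in> Vh" "\<And>i. i \<in> I \<Longrightarrow> \<exists>w\<in>Vh. g i = restrict (apply_bcontfun w) (patch \<T>H (\<phi> i) 0)"
  shows "blend \<T>H I \<phi> g \<in> blend_space Vh \<T>H I \<phi>"
proof -
  obtain w where w: "\<And>i. i \<in> I \<Longrightarrow> w i \<in> Vh \<and> g i = restrict (apply_bcontfun (w i)) (patch \<T>H (\<phi> i) 0)"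
    using assms(2) by metis
  have "blend \<T>H I \<phi> g = (\<lambda>x. apply_bcontfun 0 x +
      blend \<T>H I \<phi> (\<lambda>i. restrict (apply_bcontfun (w i)) (patch \<T>H (\<phi> i) 0)) x)"
    unfolding blend_def using w by (simp cong: sum.cong)
  then show ?thesis unfolding blend_space_def using w assms(1) by blast
qed

section \<open>Derivatives along the coarse segment\<close>

text \<open>Chain rule along a line inside \<open>VH\<close>: whatever extension
  \<open>frechet_derivative\<close> selects, its value on a coarse direction is this limit.\<close>

lemma coarse_deriv_quotient_tendsto:
  fixes M :: "'v::real_normed_vector \<Rightarrow> 'v"
  assumes diff: "M differentiable (at v within VH)" and VH: "subspace VH"
    and v: "v \<in> VH" and \<xi>: "\<xi> \<in> VH"
  shows "((\<lambda>s. (M (v + s *\<^sub>R \<xi>) - M v) /\<^sub>R s) \<longlongrightarrow> coarse_deriv VH M v \<xi>) (at (0::real))"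
proof -
  have D: "(M has_derivative coarse_deriv VH M v) (at v within VH)"
    using diff unfolding coarse_deriv_def by (simp add: frechet_derivative_works)
  have path: "v + s *\<^sub>R \<xi> \<in> VH" for s using VH v \<xi> by (simp add: subspace_add subspace_scale)
  have "((\<lambda>s. v + s *\<^sub>R \<xi>) has_derivative (\<lambda>s. s *\<^sub>R \<xi>)) (at (0::real))"
    by (auto intro!: derivative_eq_intros)
  \<comment> \<open>Shrinking the domain from \<open>VH\<close> to the image of the line gives the
    form that the chain rule expects.\<close>
  moreover have "(M has_derivative coarse_deriv VH M v)
      (at (v + 0 *\<^sub>R \<xi>) within range (\<lambda>s::real. v + s *\<^sub>R \<xi>))"
    using has_derivative_subset[OF D, of "range (\<lambda>s::real. v + s *\<^sub>R \<xi>)"] path by auto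
  ultimately have "((\<lambda>s. M (v + s *\<^sub>R \<xi>)) has_derivative (\<lambda>s. coarse_deriv VH M v (s *\<^sub>R \<xi>))) (at (0::real))"
    using has_derivative_in_compose[of "\<lambda>s. v + s *\<^sub>R \<xi>" "\<lambda>s. s *\<^sub>R \<xi>" 0 UNIV M] by simp
  then have "((\<lambda>s. norm (M (v + s *\<^sub>R \<xi>) - M v - s *\<^sub>R coarse_deriv VH M v \<xi>) / norm s) \<longlongrightarrow> 0) (at (0::real))"
    using linear_cmul[OF has_derivative_linear[OF D]] by (simp add: has_derivative_at)
  moreover have "\<forall>\<^sub>F s in at (0::real).
      norm (M (v + s *\<^sub>R \<xi>) - M v - s *\<^sub>R coarse_deriv VH M v \<xi>) / norm s =
      norm ((M (v + s *\<^sub>R \<xi>) - M v) /\<^sub>R s - coarse_deriv VH M v \<xi>)"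
    unfolding eventually_at_filter
  proof (intro always_eventually allI impI)
    fix s :: real assume s: "s \<noteq> 0"
    have "(M (v + s *\<^sub>R \<xi>) - M v) /\<^sub>R s - coarse_deriv VH M v \<xi> =
        (M (v + s *\<^sub>R \<xi>) - M v - s *\<^sub>R coarse_deriv VH M v \<xi>) /\<^sub>R s"
      using s by (simp add: scaleR_diff_right)
    then show "norm (M (v + s *\<^sub>R \<xi>) - M v - s *\<^sub>R coarse_deriv VH M v \<xi>) / norm s =
        norm ((M (v + s *\<^sub>R \<xi>) - M v) /\<^sub>R s - coarse_deriv VH M v \<xi>)"
      by (simp add: divide_inverse_commute)
  qed
  ultimately have "((\<lambda>s. norm ((M (v + s *\<^sub>R \<xi>) - M v) /\<^sub>R s - coarse_deriv VH M v \<xi>)) \<longlongrightarrow> 0) (at (0::real))"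
    by (rule Lim_transform_eventually)
  then show ?thesis by (rule LIM_zero_cancel[OF tendsto_norm_zero_cancel])
qed

text \<open>The difference quotients lie in \<open>V\<close>, and closedness passes this to their
  limit.\<close>

lemma coarse_deriv_in_closed:
  fixes M :: "'v::real_normed_vector \<Rightarrow> 'v"
  assumes diff: "M differentiable (at v within VH)" and VH: "subspace VH"
    and v: "v \<in> VH" and \<xi>: "\<xi> \<in> VH"
    and V: "subspace V" and cl: "closed V" and M: "\<And>w. w \<in> VH \<Longrightarrow> M w \<in> V"
  shows "coarse_deriv VH M v \<xi> \<in> V"
proof (rule Lim_in_closed_set[OF cl])
  show "\<forall>\<^sub>F s in at (0::real). (M (v + s *\<^sub>R \<xi>) - M v) /\<^sub>R s \<in> V"
    using M VH V v \<xi>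
    by (intro always_eventually allI) (simp add: subspace_add subspace_scale subspace_diff)
  show "((\<lambda>s. (M (v + s *\<^sub>R \<xi>) - M v) /\<^sub>R s) \<longlongrightarrow> coarse_deriv VH M v \<xi>) (at (0::real))"
    by (rule coarse_deriv_quotient_tendsto[OF diff VH v \<xi>])
qed simp

lemma linear_over_coarse_deriv:
  assumes "M differentiable (at v within VH)"
  shows "linear_over W (coarse_deriv VH M v)"
proof -
  have "linear (coarse_deriv VH M v)"
    using assms has_derivative_linear unfolding coarse_deriv_def frechet_derivative_works by blast
  then show ?thesis unfolding linear_over_def by (simp add: linear_add linear_cmul)
qed

text \<open>\<open>F\<close> need not be linear or continuous off \<open>span B\<close>, so it is
  moved inside the difference quotients, which stay in \<open>span B\<close> together with their
  limit.\<close>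

lemma DERIV_linear_over_along_line:
  fixes M :: "'v::real_normed_vector \<Rightarrow> 'v" and F :: "'v \<Rightarrow> real"
  assumes diff: "M differentiable (at (v + t *\<^sub>R \<xi>) within VH)" and VH: "subspace VH"
    and v: "v \<in> VH" and \<xi>: "\<xi> \<in> VH"
    and B: "finite B" and F: "linear_over (span B) F" and M: "\<And>w. w \<in> VH \<Longrightarrow> M w \<in> span B"
  shows "((\<lambda>s. F (M (v + s *\<^sub>R \<xi>))) has_real_derivative F (coarse_deriv VH M (v + t *\<^sub>R \<xi>) \<xi>)) (at t)"
proof -
  let ?q = "\<lambda>s. (M ((v + t *\<^sub>R \<xi>) + s *\<^sub>R \<xi>) - M (v + t *\<^sub>R \<xi>)) /\<^sub>R s"
  have path: "v + s *\<^sub>R \<xi> \<in> VH" for s using VH v \<xi> by (simp add: subspace_add subspace_scale)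
  have shift: "(v + t *\<^sub>R \<xi>) + s *\<^sub>R \<xi> = v + (t + s) *\<^sub>R \<xi>" for s by (simp add: algebra_simps)
  have in_span: "M (v + (t + s) *\<^sub>R \<xi>) - M (v + t *\<^sub>R \<xi>) \<in> span B" for s
    using M path by (simp add: span_diff)
  have "((\<lambda>s. F (?q s)) \<longlongrightarrow> F (coarse_deriv VH M (v + t *\<^sub>R \<xi>) \<xi>)) (at 0)"
  proof (rule linear_over_span_tendsto[OF B F])
    show "(?q \<longlongrightarrow> coarse_deriv VH M (v + t *\<^sub>R \<xi>) \<xi>) (at 0)"
      by (rule coarse_deriv_quotient_tendsto[OF diff VH path \<xi>])
    show "\<forall>\<^sub>F s in at 0. ?q s \<in> span B"
      unfolding shift by (intro always_eventually allI span_scale in_span)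
    show "coarse_deriv VH M (v + t *\<^sub>R \<xi>) \<xi> \<in> span B"
      by (rule coarse_deriv_in_closed[OF diff VH path \<xi> subspace_span closed_span_finite[OF B] M])
  qed
  moreover have "F (?q s) = (F (M (v + (t + s) *\<^sub>R \<xi>)) - F (M (v + t *\<^sub>R \<xi>))) / s" for s
    unfolding shift
    by (simp only: linear_over_scale[OF F in_span] linear_over_diff[OF F M[OF path] M[OF path]]
        divide_inverse real_scaleR_def mult.commute)
  ultimately show ?thesis unfolding DERIV_def by simp
qed

text \<open>A monotonicity argument replaces the integral form of the remainder, so nothing about
  integrability of \<open>f'\<close> enters.\<close>

lemma taylor_remainder_le:
  fixes f f' :: "real \<Rightarrow> real"
  assumes f: "\<And>s. 0 \<le> s \<Longrightarrow> s \<le> 1 \<Longrightarrow> (f has_real_derivative f' s) (at s)"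
    and f': "\<And>s. 0 \<le> s \<Longrightarrow> s \<le> 1 \<Longrightarrow> f' s - f' 0 \<le> K * s"
  shows "f 1 - f 0 - f' 0 \<le> K / 2"
proof -
  \<comment> \<open>The quadratic term is chosen so that the derivative
    \<open>f' s - f' 0 - K * s\<close> is nonpositive.\<close>
  define h where "h s = f s - s * f' 0 - K * s\<^sup>2 / 2" for s
  have "h 1 \<le> h 0"
  proof (rule DERIV_nonpos_imp_nonincreasing[of 0 1])
    fix s :: real assume s: "0 \<le> s" "s \<le> 1"
    have "(h has_real_derivative f' s - f' 0 - K * s) (at s)"
      unfolding h_def using f[OF s] by (auto intro!: derivative_eq_intros)
    then show "\<exists>y. (h has_real_derivative y) (at s) \<and> y \<le> 0"
      using f'[OF s] by (intro exI[of _ "f' s - f' 0 - K * s"]) simp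
  qed simp
  then show ?thesis unfolding h_def by simp
qed

theorem proposition7p3:
  fixes \<Omega> :: "'a::euclidean_space set"
    and \<T>H \<T>h :: "'a set set"
    and VH Vh Vf BH Bh UH Uh :: "('a \<Rightarrow>\<^sub>C real) set"
    and a A :: "('a \<Rightarrow>\<^sub>C real) \<Rightarrow> ('a \<Rightarrow>\<^sub>C real) \<Rightarrow> real"
    and L :: "('a \<Rightarrow>\<^sub>C real) \<Rightarrow> real"
    and nV :: "('a \<Rightarrow>\<^sub>C real) \<Rightarrow> real"
    and \<Pi>H Mh Mt :: "('a \<Rightarrow>\<^sub>C real) \<Rightarrow> ('a \<Rightarrow>\<^sub>C real)"
    and DM :: "('a \<Rightarrow>\<^sub>C real) \<Rightarrow> ('a \<Rightarrow>\<^sub>C real) \<Rightarrow> ('a \<Rightarrow>\<^sub>C real)"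
    and Ih :: "('a \<Rightarrow> real) \<Rightarrow> ('a \<Rightarrow>\<^sub>C real)"
    and I :: "'i set"
    and \<phi> :: "'i \<Rightarrow> 'a \<Rightarrow> real"
    and l :: nat
    and \<omega> \<omega>0 :: "'i \<Rightarrow> 'a set"
    and Aloc :: "'i \<Rightarrow> ('a \<Rightarrow>\<^sub>C real) \<Rightarrow> ('a \<Rightarrow>\<^sub>C real) \<Rightarrow> real"
    and Lloc :: "'i \<Rightarrow> ('a \<Rightarrow>\<^sub>C real) \<Rightarrow> real"
    and \<N> :: "'i \<Rightarrow> 'p \<Rightarrow> (('a \<Rightarrow>\<^sub>C real) \<Rightarrow> real) \<Rightarrow> (('a \<Rightarrow>\<^sub>C real) \<Rightarrow> real)"
    and \<theta> :: "'i \<Rightarrow> 'p"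
    and g :: "'i \<Rightarrow> (('a \<Rightarrow>\<^sub>C real) \<Rightarrow> real) \<Rightarrow> 'a \<Rightarrow> real"
    and uh uH ums eh eloc :: "'a \<Rightarrow>\<^sub>C real"
    and \<sigma> \<rho> C\<Pi> CI mA LA LM \<gamma> :: real
  \<comment> \<open>domain, meshes, finite element spaces, energy norm\<close>
  assumes "polyhedral_domain \<Omega>"
    and "mesh_of \<Omega> \<T>H" and "mesh_of \<Omega> \<T>h" and "mesh_refines \<T>h \<T>H"
    and "shape_regular \<sigma> \<T>H" and "shape_regular \<sigma> \<T>h"
    and "quasi_uniform \<rho> \<T>H" and "quasi_uniform \<rho> \<T>h"
    and VH: "VH = p1_space \<Omega> \<T>H" and Vh: "Vh = p1_space \<Omega> \<T>h"
    and "is_basis BH VH" and "is_basis Bh Vh"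
    and "energy_form Vh a" and nV: "nV = energy_norm a"
  \<comment> \<open>fine problem\<close>
    and "\<And>v. v \<in> Vh \<Longrightarrow> linear_over Vh (A v)" and "linear_over Vh L"
    and "uh \<in> Vh" and "\<And>v. v \<in> Vh \<Longrightarrow> A uh v = L v"
    and "\<And>u. u \<in> Vh \<Longrightarrow> (\<And>v. v \<in> Vh \<Longrightarrow> A u v = L v) \<Longrightarrow> u = uh"
  \<comment> \<open>coarse projection and ideal reconstruction\<close>
    and "linear_over Vh \<Pi>H" and "\<And>v. v \<in> Vh \<Longrightarrow> \<Pi>H v \<in> VH" and "\<And>v. v \<in> VH \<Longrightarrow> \<Pi>H v = v"
    and "\<And>v. v \<in> Vh \<Longrightarrow> nV (\<Pi>H v) \<le> C\<Pi> * nV v"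
    and Vf: "Vf = fine_space Vh \<Pi>H"
    and "\<And>vH. vH \<in> VH \<Longrightarrow> \<exists>!v. is_correction A L Vf vH v"
    and Mh: "Mh = ideal_reconstruction A L Vf"
  \<comment> \<open>patches, local corrections, computable reconstruction\<close>
    and "coarse_partition_of_unity \<Omega> \<T>H I \<phi>"
    and \<omega>0: "\<omega>0 = (\<lambda>i. patch \<T>H (\<phi> i) 0)" and \<omega>: "\<omega> = (\<lambda>i. patch \<T>H (\<phi> i) l)"
    and "\<And>i. i \<in> I \<Longrightarrow> patch_restriction Vh (\<omega> i) A L (Aloc i) (Lloc i)"
    and "\<And>i vH. i \<in> I \<Longrightarrow> vH \<in> VH \<Longrightarrow>
           \<exists>!v. is_correction (Aloc i) (Lloc i) (patch_fine_space Vf (\<omega> i)) vH v"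
    and "fine_interpolation CI Vh (blend_space Vh \<T>H I \<phi>) Ih"
    and "(\<forall>i\<in>I. \<forall>p. g i p =
            restrict (apply_bcontfun
              (local_correction VH BH Vf (\<omega> i) (Aloc i) (Lloc i) p)) (\<omega>0 i)) \<or>
         (\<forall>i\<in>I. \<forall>p. g i p = fe_of_coeffs Bh (\<omega>0 i) (\<N> i (\<theta> i) p))"
    and Mt: "Mt = computable_reconstruction \<Pi>H Ih \<T>H BH I \<phi> l g"
  \<comment> \<open>admissible sets, differentiability, computed coarse state\<close>
    and "Uh \<subseteq> Vh" and "UH \<subseteq> VH"
    and "\<And>vH. vH \<in> UH \<Longrightarrow> Mt differentiable (at vH within VH)"
    and DM: "DM = coarse_deriv VH Mt"
    and "uH \<in> VH" and ums: "ums = Mt uH"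
    and "\<And>s. 0 \<le> s \<Longrightarrow> s \<le> 1 \<Longrightarrow> uH + s *\<^sub>R (\<Pi>H uh - uH) \<in> UH"
    and "uh \<in> Uh" and "ums \<in> Uh" and "Mt (\<Pi>H uh) \<in> Uh"
  \<comment> \<open>strong monotonicity, Lipschitz continuity, Lipschitz derivative\<close>
    and "0 < mA" and "0 < LA"
    and "\<And>v w. v \<in> Uh \<Longrightarrow> w \<in> Uh \<Longrightarrow> mA * (nV (v - w))\<^sup>2 \<le> A v (v - w) - A w (v - w)"
    and "\<And>v w. v \<in> Uh \<Longrightarrow> w \<in> Uh \<Longrightarrow>
           dual_norm nV Vh (\<lambda>z. A v z - A w z) \<le> LA * nV (v - w)"
    and "\<And>vH wH \<xi>. vH \<in> UH \<Longrightarrow> wH \<in> UH \<Longrightarrow> \<xi> \<in> VH \<Longrightarrow>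
           nV (DM vH \<xi> - DM wH \<xi>) \<le> LM * nV (vH - wH) * nV \<xi>"
    and eh: "eh = uh - ums" and \<gamma>: "\<gamma> = 1/2 * LA * LM * C\<Pi>\<^sup>2"
    and eloc: "eloc = Mh (\<Pi>H uh) - Mt (\<Pi>H uh)"
    and "\<gamma> * nV eh \<le> 1/2 * mA"
  shows "nV (uh - ums) \<le>
           2 / mA * (LA * nV eloc + C\<Pi> * dual_norm nV VH (reduced_residual A L VH Mt uH))"
proof -

  \<comment> \<open>Spaces and the energy norm\<close>
  have BH: "finite BH" "span BH = VH" and Bh: "finite Bh" "span Bh = Vh"
    using assms(11,12) unfolding is_basis_def by auto
  have sVH: "subspace VH" and sVh: "subspace Vh" using BH Bh subspace_span by metis+
  have VHh: "VH \<subseteq> Vh" using p1_space_mono[OF assms(4)] VH Vh by blast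
  have Vfh: "Vf \<subseteq> Vh" unfolding Vf fine_space_def by blast
  have enh: "energy_form (span Bh) a" and enH: "energy_form (span BH) a"
    using assms(13) energy_form_subset[OF assms(13) VHh] BH Bh by auto
  have nV_nonneg: "0 \<le> nV v" if "v \<in> Vh" for v
    unfolding nV by (rule energy_norm_nonneg[OF assms(13) sVh that])
  have nV_pos: "0 < nV v" if "v \<in> Vh" "v \<noteq> 0" for v
    unfolding nV by (rule energy_norm_pos[OF assms(13) that])
  have nV_scale: "nV (c *\<^sub>R v) = \<bar>c\<bar> * nV v" if "v \<in> Vh" for c v
    unfolding nV by (rule energy_norm_scale[OF assms(13) sVh that])

  \<comment> \<open>The computable reconstruction as a right inverse of the projection\<close>
  note Ih = assms(32)[unfolded fine_interpolation_def]

  \<comment> \<open>Both variants, patch-solved and network-interpolated, are reduced to this common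
    form; the rest of the proof no longer distinguishes them.\<close>
  have g_restrict: "\<exists>w\<in>Vh. g i (patch_coeffs BH (\<omega> i) v) = restrict (apply_bcontfun w) (\<omega>0 i)"
    if i: "i \<in> I" and v: "v \<in> VH" for i v
    using assms(33)
  proof
    assume "\<forall>i\<in>I. \<forall>p. g i p = restrict (apply_bcontfun
        (local_correction VH BH Vf (\<omega> i) (Aloc i) (Lloc i) p)) (\<omega>0 i)"
    moreover have "local_correction VH BH Vf (\<omega> i) (Aloc i) (Lloc i) (patch_coeffs BH (\<omega> i) v) \<in> Vf"
      by (rule local_correction_in_fine[OF assms(11) v VHh sVh Vfh _ assms(30)[OF i] assms(31)[OF i]])
        (simp_all add: \<omega> open_patch)
    ultimately show ?thesis using Vfh i by blast
  next
    assume "\<forall>i\<in>I. \<forall>p. g i p = fe_of_coeffs Bh (\<omega>0 i) (\<N> i (\<theta> i) p)"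
    then show ?thesis using fe_of_coeffs_restrict[OF assms(12)] i by simp
  qed
  have Mt_form: "\<exists>w\<in>Vh. Mt v = v + (w - \<Pi>H w)" if v: "v \<in> VH" for v
  proof -
    have "blend \<T>H I \<phi> (\<lambda>i. g i (patch_coeffs BH (\<omega> i) v)) \<in> blend_space Vh \<T>H I \<phi>"
      using g_restrict[OF _ v] subspace_0[OF sVh] unfolding \<omega>0 by (intro blend_in_blend_space)
    then have "Ih (blend \<T>H I \<phi> (\<lambda>i. g i (patch_coeffs BH (\<omega> i) v))) \<in> Vh" using Ih by blast
    then show ?thesis
      unfolding Mt computable_reconstruction_def Let_def \<omega> by blast
  qed
  have MtVh: "Mt v \<in> Vh" if v: "v \<in> VH" for v
  proof -
    obtain w where w: "w \<in> Vh" "Mt v = v + (w - \<Pi>H w)" using Mt_form[OF v] by blast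
    have "v \<in> Vh" "\<Pi>H w \<in> Vh" using v w assms(21) VHh by blast+
    then show ?thesis unfolding w(2) using w(1) sVh by (simp add: subspace_add subspace_diff)
  qed
  have \<Pi>Mt: "\<Pi>H (Mt v) = v" if v: "v \<in> VH" for v
  proof -
    obtain w where w: "w \<in> Vh" "Mt v = v + (w - \<Pi>H w)" using Mt_form[OF v] by blast
    have in_Vh: "v \<in> Vh" "\<Pi>H w \<in> Vh" using v w assms(21) VHh by blast+
    \<comment> \<open>The fine part is annihilated, since \<open>\<Pi>H\<close> fixes
      \<open>\<Pi>H w\<close>.\<close>
    then have "w - \<Pi>H w \<in> Vh" using w(1) sVh by (simp add: subspace_diff)
    then show ?thesis
      using linear_over_add[OF assms(20)] linear_over_diff[OF assms(20)] in_Vh w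
        assms(22)[OF v] assms(22)[OF assms(21)[OF w(1)]] by simp
  qed

  \<comment> \<open>Coarse error and localization error\<close>
  define d where "d = \<Pi>H uh - uH"
  have \<Pi>uh: "\<Pi>H uh \<in> VH" using assms(17) by (rule assms(21))
  have dVH: "d \<in> VH" unfolding d_def using sVH \<Pi>uh assms(39) by (rule subspace_diff)
  have dVh: "d \<in> Vh" using dVH VHh by blast
  have umsVh: "ums \<in> Vh" unfolding ums by (rule MtVh[OF assms(39)])
  have eVh: "eh \<in> Vh" unfolding eh using sVh assms(17) umsVh by (rule subspace_diff)
  have seg: "uH + s *\<^sub>R d \<in> UH" if "0 \<le> s" "s \<le> 1" for s
    unfolding d_def using that by (rule assms(41))
  have uH: "uH \<in> UH" using seg[of 0] by simp
  have d_eq: "d = \<Pi>H eh"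
    unfolding d_def eh using linear_over_diff[OF assms(20) assms(17) umsVh] \<Pi>Mt[OF assms(39)] ums by simp
  \<comment> \<open>The fine part \<open>uh - \<Pi>H uh\<close> solves the correction problem
    because \<open>uh\<close> satisfies the equation for all test functions in \<open>Vh\<close>;
    uniqueness does the rest.\<close>
  have "Mh (\<Pi>H uh) = uh"
    unfolding Mh
  proof (rule ideal_reconstruction_eqI[OF assms(25)[OF \<Pi>uh]])
    have "\<Pi>H uh \<in> Vh" using \<Pi>uh VHh by blast
    then show "uh - \<Pi>H uh \<in> Vf"
      unfolding Vf fine_space_def
      using linear_over_diff[OF assms(20) assms(17)] assms(17) assms(22)[OF \<Pi>uh] sVh
      by (simp add: subspace_diff)
    show "A uh w = L w" if "w \<in> Vf" for w using that Vfh assms(18) by blast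
  qed
  then have eloc_eq: "eloc = uh - Mt (\<Pi>H uh)" unfolding eloc by simp
  have elocVh: "eloc \<in> Vh"
    unfolding eloc_eq using sVh assms(17) MtVh[OF \<Pi>uh] by (rule subspace_diff)

  \<comment> \<open>Residual and reduced residual\<close>
  define R where "R z = A uh z - A ums z" for z
  have R_lin: "linear_over (span Bh) R"
    unfolding R_def Bh(2)
    using assms(15)[OF assms(17)] assms(15)[OF umsVh] by (rule linear_over_diff_fun)
  have R_bound: "\<bar>R z\<bar> \<le> LA * nV eh * nV z" if z: "z \<in> Vh" for z
  proof -
    have "\<bar>R z\<bar> \<le> dual_norm nV Vh R * nV z"
      using dual_norm_bound[OF Bh(1) enh R_lin] z unfolding Bh(2) nV by blast
    also have "\<dots> \<le> LA * nV eh * nV z"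
      using assms(48)[OF assms(42,43)] nV_nonneg[OF z] unfolding R_def eh by (rule mult_right_mono)
    finally show ?thesis .
  qed
  \<comment> \<open>Since \<open>uh\<close> solves the fine problem, the difference to which
    monotonicity and Lipschitz continuity apply is the residual at \<open>ums\<close>.\<close>
  have R_res: "R z = residual A L ums z" if "z \<in> Vh" for z
    unfolding R_def residual_def using assms(18)[OF that] by simp

  have DMVh: "DM v \<xi> \<in> Vh" if "v \<in> UH" "\<xi> \<in> VH" for v \<xi>
    unfolding DM Bh(2)[symmetric]
    using that assms(36) MtVh Bh(2)
    by (intro coarse_deriv_in_closed[OF assms(37) sVH _ _ subspace_span closed_span_finite[OF Bh(1)]]) auto
  have red_eq: "reduced_residual A L VH Mt uH \<xi> = R (DM uH \<xi>)" if "\<xi> \<in> VH" for \<xi>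
    unfolding reduced_residual_def using R_res[OF DMVh[OF uH that]] unfolding DM ums by simp
  have red_lin: "linear_over (span BH) (reduced_residual A L VH Mt uH)"
    unfolding linear_over_def BH(2)
  proof (intro ballI allI)
    fix x y c k assume xy: "x \<in> VH" "y \<in> VH"
    then have xy': "c *\<^sub>R x + k *\<^sub>R y \<in> VH" using sVH by (simp add: subspace_add subspace_scale)
    have "DM uH (c *\<^sub>R x + k *\<^sub>R y) = c *\<^sub>R DM uH x + k *\<^sub>R DM uH y"
      using linear_over_coarse_deriv[OF assms(37)[OF uH], of VH] xy
      unfolding DM linear_over_def by blast
    moreover have "R (c *\<^sub>R DM uH x + k *\<^sub>R DM uH y) = c *\<^sub>R R (DM uH x) + k *\<^sub>R R (DM uH y)"
      using R_lin DMVh[OF uH xy(1)] DMVh[OF uH xy(2)] unfolding Bh(2) linear_over_def by blast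
    ultimately show "reduced_residual A L VH Mt uH (c *\<^sub>R x + k *\<^sub>R y) =
        c *\<^sub>R reduced_residual A L VH Mt uH x + k *\<^sub>R reduced_residual A L VH Mt uH y"
      using red_eq xy xy' by simp
  qed
  define D where "D = dual_norm nV VH (reduced_residual A L VH Mt uH)"
  have D_nonneg: "0 \<le> D"
    using dual_norm_nonneg[OF BH(1) enH red_lin] unfolding D_def nV BH(2) .
  have D_bound: "R (DM uH d) \<le> D * nV d"
    using dual_norm_bound[OF BH(1) enH red_lin, of d] dVH red_eq[OF dVH]
    unfolding D_def nV BH(2) by simp

  \<comment> \<open>Taylor remainder and its absorption\<close>
  define q where "q = nV d"
  define n where "n = nV eh"
  have n_nonneg: "0 \<le> n" unfolding n_def by (rule nV_nonneg[OF eVh])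
  have q_nonneg: "0 \<le> q" unfolding q_def by (rule nV_nonneg[OF dVh])
  have q_le: "q \<le> C\<Pi> * n" unfolding q_def n_def d_eq by (rule assms(23)[OF eVh])
  \<comment> \<open>Taylor's formula is applied to the scalar function
    \<open>s \<mapsto> R (Mt (uH + s *\<^sub>R d))\<close>, which avoids estimating a vector-valued
    remainder. At \<open>s = 1\<close> the segment reaches \<open>\<Pi>H uh\<close>.\<close>
  have taylor: "R (Mt (\<Pi>H uh)) - R (Mt uH) - R (DM uH d) \<le> LA * n * LM * q\<^sup>2 / 2"
  proof -
    have "R (Mt (uH + 1 *\<^sub>R d)) - R (Mt (uH + 0 *\<^sub>R d)) - R (DM (uH + 0 *\<^sub>R d) d)
        \<le> (LA * n * LM * q\<^sup>2) / 2"
    proof (rule taylor_remainder_le)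
      fix s :: real assume s: "0 \<le> s" "s \<le> 1"
      show "((\<lambda>s. R (Mt (uH + s *\<^sub>R d))) has_real_derivative R (DM (uH + s *\<^sub>R d) d)) (at s)"
        unfolding DM using MtVh Bh(2)
        by (intro DERIV_linear_over_along_line[OF assms(37)[OF seg[OF s]] sVH assms(39) dVH Bh(1) R_lin]) simp
      have s0: "DM (uH + s *\<^sub>R d) d \<in> Vh" "DM uH d \<in> Vh" using DMVh seg[OF s] uH dVH by blast+
      then have diff: "DM (uH + s *\<^sub>R d) d - DM uH d \<in> Vh" using sVh by (simp add: subspace_diff)
      have "R (DM (uH + s *\<^sub>R d) d) - R (DM uH d) = R (DM (uH + s *\<^sub>R d) d - DM uH d)"
        using linear_over_diff[OF R_lin] s0 Bh(2) by simp
      also have "\<dots> \<le> LA * n * nV (DM (uH + s *\<^sub>R d) d - DM uH d)"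
        using R_bound[OF diff] unfolding n_def by linarith
      also have "\<dots> \<le> LA * n * (LM * nV ((uH + s *\<^sub>R d) - uH) * nV d)"
        using assms(49)[OF seg[OF s] uH dVH] assms(46) n_nonneg by (intro mult_left_mono) auto
      also have "nV ((uH + s *\<^sub>R d) - uH) = s * q"
        using nV_scale[OF dVh] s unfolding q_def by simp
      also have "LA * n * (LM * (s * q) * nV d) = LA * n * LM * q\<^sup>2 * s"
        unfolding q_def by (simp add: power2_eq_square)
      finally show "R (DM (uH + s *\<^sub>R d) d) - R (DM (uH + 0 *\<^sub>R d) d) \<le> LA * n * LM * q\<^sup>2 * s" by simp
    qed
    then show ?thesis unfolding d_def by simp
  qed
  \<comment> \<open>The sign of \<^term>\<open>LM\<close> is not given, but \<open>LM \<ge> 0\<close> follows from the Lipschitz bound unless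
    \<open>d = 0\<close>.\<close>
  have cubic: "LA * n * LM * q\<^sup>2 / 2 \<le> mA / 2 * n\<^sup>2"
  proof (cases "d = 0")
    case True
    then have "q = 0" unfolding q_def using nV_scale[OF dVh, of 0] by simp
    then show ?thesis using assms(45) by simp
  next
    case False
    then have q_pos: "0 < q" unfolding q_def using dVh nV_pos by blast
    have u1: "uH + d \<in> UH" using seg[of 1] by simp
    have "DM (uH + d) d - DM uH d \<in> Vh"
      using DMVh[OF u1 dVH] DMVh[OF uH dVH] sVh by (simp add: subspace_diff)
    then have "0 \<le> LM * q * q"
      using assms(49)[OF u1 uH dVH] nV_nonneg unfolding q_def by fastforce
    then have "0 \<le> LM" using q_pos by (simp add: zero_le_mult_iff)
    moreover have "q\<^sup>2 \<le> (C\<Pi> * n)\<^sup>2" using q_le q_nonneg by (rule power_mono)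
    ultimately have "LA * n * LM * q\<^sup>2 \<le> LA * n * LM * (C\<Pi> * n)\<^sup>2"
      using assms(46) n_nonneg by (intro mult_left_mono) auto
    \<comment> \<open>The factor 1/2 from Taylor is the one in \<open>\<gamma>\<close>, and
      \<open>C\<Pi>\<^sup>2\<close> comes from bounding \<open>q\<close> by
      \<open>C\<Pi> * n\<close>.\<close>
    then have "LA * n * LM * q\<^sup>2 / 2 \<le> (\<gamma> * n) * n\<^sup>2"
      unfolding \<gamma> by (simp add: power2_eq_square mult_ac)
    also have "\<dots> \<le> mA / 2 * n\<^sup>2"
      using assms(53) unfolding n_def by (intro mult_right_mono) auto
    finally show ?thesis .
  qed

  \<comment> \<open>Collecting the estimates\<close>
  have main: "mA * n\<^sup>2 \<le> LA * n * nV eloc + D * q + LA * n * LM * q\<^sup>2 / 2"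
  proof -
    have "mA * n\<^sup>2 \<le> R eh"
      using assms(47)[OF assms(42,43)] unfolding R_def n_def eh .
    also have "eh = eloc + (Mt (\<Pi>H uh) - Mt uH)" unfolding eh eloc_eq ums by simp
    also have "R (eloc + (Mt (\<Pi>H uh) - Mt uH)) = R eloc + (R (Mt (\<Pi>H uh)) - R (Mt uH))"
    proof -
      have M: "Mt (\<Pi>H uh) \<in> span Bh" "Mt uH \<in> span Bh" "eloc \<in> span Bh"
        using MtVh \<Pi>uh assms(39) elocVh Bh(2) by auto
      show ?thesis
        using linear_over_add[OF R_lin M(3) span_diff[OF M(1,2)]] linear_over_diff[OF R_lin M(1,2)]
        by simp
    qed
    finally show ?thesis
      using taylor D_bound R_bound[OF elocVh] unfolding q_def n_def by linarith
  qed
  \<comment> \<open>Needed when \<open>n = 0\<close>, where one cannot divide by \<open>n\<close>. A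
    nonzero coarse function is fixed by the projection, which forces \<open>C\<Pi>\<close> to be
    positive; otherwise the dual norm vanishes.\<close>
  have CD: "0 \<le> C\<Pi> * D"
  proof (cases "VH \<subseteq> {0}")
    case True
    then show ?thesis unfolding D_def by (simp add: dual_norm_zero_space[of VH])
  next
    case False
    then obtain v where v: "v \<in> VH" "v \<noteq> 0" by blast
    then have "v \<in> Vh" using VHh by blast
    then have "0 < nV v" "nV v \<le> C\<Pi> * nV v"
      using nV_pos v(2) assms(23)[of v] assms(22)[OF v(1)] by auto
    then have "0 \<le> C\<Pi>" by simp
    then show ?thesis using D_nonneg by simp
  qed
  have "D * q \<le> D * (C\<Pi> * n)" using q_le D_nonneg by (rule mult_left_mono)
  \<comment> \<open>Half of \<open>mA * n\<^sup>2\<close> absorbs the cubic term; every remaining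
    term carries a factor \<open>n\<close>.\<close>
  with main cubic have quad: "mA / 2 * n * n \<le> (LA * nV eloc + C\<Pi> * D) * n"
    by (simp add: algebra_simps power2_eq_square)
  have "mA / 2 * n \<le> LA * nV eloc + C\<Pi> * D"
  proof (cases "n = 0")
    case True
    then show ?thesis using CD assms(46) nV_nonneg[OF elocVh] by simp
  next
    case False
    then show ?thesis using quad n_nonneg mult_right_le_imp_le[of "mA / 2 * n" n] by simp
  qed
  then have "n \<le> 2 / mA * (LA * nV eloc + C\<Pi> * D)" using assms(45) by (simp add: field_simps)
  then show ?thesis unfolding n_def D_def eh .
qed

end
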